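(* Let $B=5$, let $\tilde p<0$ be an integer and $\tilde q$ a positive integer with $\tilde q\geqslant 3600\sqrt[3]{|\tilde p|}$ and $2\tilde q>|\tilde p|$. Let $F_2=B^{2}\tilde q^{6}-2B\tilde q^{4}-2B\tilde p\tilde q^{3}-2\tilde q^{2}+2\tilde p\tilde q+\tilde p^{2}-\frac5B-\frac{20}{B^{2}\tilde q^{2}}$. Then there is no integer $t$ with $F_2<t<F_2-\frac{10\tilde p}{B^{2}\tilde q^{3}}$. *)

theory Defs
  imports Complex_Main
begin

definition F2 :: "real \<Rightarrow> real \<Rightarrow> real \<Rightarrow> real" where
  "F2 B p q = B^2 * q^6 - 2 * B * q^4 - 2 * B * p * q^3 - 2 * q^2 + 2 * p * q + p^2
     - 5 / B - 20 / (B^2 * q^2)"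

end

theory Submission
  imports Defs
begin

text \<open>For \<open>B = 5\<close> all terms of \<open>F\<^sub>2\<close> but the last are integers, so \<open>F\<^sub>2 = N - 4 / (5 q\<^sup>2)\<close> with \<open>N\<close> an
  integer. Since \<open>\<bar>p\<bar> < 2 q\<close>, the length \<open>2 \<bar>p\<bar> / (5 q\<^sup>3)\<close> of the interval is less than
  \<open>4 / (5 q\<^sup>2) < 1\<close>, so the interval lies strictly between \<open>N - 1\<close> and \<open>N\<close>.\<close>

theorem theorem7p7:
  fixes B :: real and p q :: int
  assumes "B = 5"
    and "p < 0"
    and "q > 0"
    and "real_of_int q \<ge> 3600 * root 3 \<bar>real_of_int p\<bar>"
    and "2 * q > \<bar>p\<bar>"
  shows "\<not> (\<exists>t::int. F2 B (real_of_int p) (real_of_int q) < real_of_int t \<and>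
           real_of_int t < F2 B (real_of_int p) (real_of_int q)
             - 10 * real_of_int p / (B^2 * (real_of_int q)^3))"
proof
  \<comment> \<open>The final \<open>- 1\<close> is \<open>- 5 / B\<close> at \<open>B = 5\<close>;
    the omitted term \<open>20 / (B^2 * q^2)\<close> becomes \<open>4 / (5 * q^2)\<close>.\<close>
  define N :: int where
    "N = 25 * q^6 - 10 * q^4 - 10 * p * q^3 - 2 * q^2 + 2 * p * q + p^2 - 1"
  define P Q where "P = real_of_int p" and "Q = real_of_int q"
  have Q: "Q \<ge> 1" and PQ: "- P < 2 * Q"
    using assms unfolding P_def Q_def by linarith+
  have F2_eq: "F2 B P Q = real_of_int N - 4 / (5 * Q^2)"
    by (simp add: F2_def N_def P_def Q_def \<open>B = 5\<close>)
  have "Q^2 \<ge> 1"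
    using Q by simp
  then have small: "4 / (5 * Q^2) < 1"
    by (simp add: divide_simps)
  have "- (10 * P / (B^2 * Q^3)) = 2 * (- P) / (5 * Q^3)"
    by (simp add: \<open>B = 5\<close>)
  \<comment> \<open>Trading \<open>- P\<close> for \<open>2 * Q\<close> cancels one factor of the
    cube, leaving exactly the gap between \<open>F2 B P Q\<close> and \<open>N\<close>.\<close>
  also have "\<dots> < 2 * (2 * Q) / (5 * Q^3)"
    using PQ Q by (intro divide_strict_right_mono) auto
  also have "\<dots> = 4 / (5 * Q^2)"
    using Q by (simp add: power2_eq_square power3_eq_cube)
  finally have width: "- (10 * P / (B^2 * Q^3)) < 4 / (5 * Q^2)" .
  assume "\<exists>t::int. F2 B (real_of_int p) (real_of_int q) < real_of_int t \<and>
           real_of_int t < F2 B (real_of_int p) (real_of_int q)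
             - 10 * real_of_int p / (B^2 * (real_of_int q)^3)"
  then obtain t :: int where "F2 B P Q < t" "t < F2 B P Q - 10 * P / (B^2 * Q^3)"
    unfolding P_def Q_def by blast
  \<comment> \<open>\<open>small\<close> keeps the left end above \<open>N - 1\<close>;
    \<open>width\<close> keeps the right end below \<open>N\<close>.\<close>
  then have "real_of_int (N - 1) < real_of_int t" "real_of_int t < real_of_int N"
    using F2_eq small width by simp_all
  then show False
    unfolding of_int_less_iff by linarith
qed

end
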